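(* Let $\mathcal{H}$ be a real Hilbert space, let $F:\mathcal{H}\to\mathcal{H}$ be continuous and monotone, and suppose that the equation $F(x)=0$ has at least one solution in $\mathcal{H}$. Let $p\ge 1$ be an integer, let $x_0\in\mathcal{H}$ with $F(x_0)\neq 0$, and let $(x,v,s):[0,+\infty)\to\mathcal{H}\times\mathcal{H}\times\mathcal{H}$ be a global solution of the accelerated rescaled gradient system (defined in the context) with parameter $p$ and initial point $x_0$. Then $$\|F(x(t))\| = O(t^{-p/2}),$$ i.e., there is a constant $C>0$ independent of $t$ such that $\|F(x(t))\|\le C\,t^{-p/2}$ for all $t>0$.
   Context: $F$ is monotone if $\langle F(x)-F(y),x-y\rangle\ge 0$ for all $x,y\in\mathcal{H}$. The accelerated rescaled gradient system with parameter $p\in\{1,2,\ldots\}$ and initial point $x_0$ (where $F(x_0)\ne 0$) is $$\dot s(t)=-\frac{F(x(t))}{\|F(x(t))\|^{1-1/p}},\qquad v(t)=x_0+s(t),\qquad x(t)-v(t)+\frac{F(x(t))}{\|F(x(t))\|^{1-1/p}}=0,$$ with $s(0)=0$ (equivalently $v(0)=x_0$). A global solution is a triple $(x,v,s):[0,+\infty)\to\mathcal{H}\times\mathcal{H}\times\mathcal{H}$ with $s$ differentiable, $F(x(t))\neq 0$ for all $t$ (so that the expressions make sense), satisfying these relations for all $t\ge0$. For $p=1$ the factor $\|F(x(t))\|^{1-1/p}$ is $1$. *)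

theory Defs
  imports "HOL-Analysis.Analysis"
begin

definition monotone_operator :: "('a::real_inner \<Rightarrow> 'a) \<Rightarrow> bool" where
  "monotone_operator F \<longleftrightarrow> (\<forall>x y. inner (F x - F y) (x - y) \<ge> 0)"

text \<open>
  The direction \<open>F(x) / \<parallel>F(x)\<parallel>\<^sup>1\<^sup>-\<^sup>1\<^sup>/\<^sup>p\<close>. It is meant for \<open>F x \<noteq> 0\<close> and \<open>p \<ge> 1\<close> only;
  for \<open>p = 1\<close> it is then \<open>F x\<close>, since \<open>r powr 0 = 1\<close> for \<open>r \<noteq> 0\<close>.
\<close>

definition rescaled :: "('a::real_normed_vector \<Rightarrow> 'a) \<Rightarrow> nat \<Rightarrow> 'a \<Rightarrow> 'a" where
  "rescaled F p x = F x /\<^sub>R (norm (F x) powr (1 - 1 / real p))"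

text \<open>
  Trajectories on \<open>[0, \<infinity>)\<close> are total functions on the reals of which only the values at
  \<open>t \<ge> 0\<close> matter; the derivative at \<open>t = 0\<close> is accordingly one-sided.
\<close>

definition accelerated_rescaled_gradient_solution ::
  "('a::real_normed_vector \<Rightarrow> 'a) \<Rightarrow> nat \<Rightarrow> 'a \<Rightarrow> (real \<Rightarrow> 'a) \<Rightarrow> (real \<Rightarrow> 'a) \<Rightarrow> (real \<Rightarrow> 'a) \<Rightarrow> bool"
where
  "accelerated_rescaled_gradient_solution F p x0 x v s \<longleftrightarrow>
     s 0 = 0 \<and>
     (\<forall>t\<ge>0. F (x t) \<noteq> 0 \<and>
            (s has_vector_derivative - rescaled F p (x t)) (at t within {0..}) \<and>
            v t = x0 + s t \<and>
            x t - v t + rescaled F p (x t) = 0)"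

end

theory Submission
  imports Defs
begin

text \<open>
  Put \<open>d(t) = v(t) - x(t)\<close>, so that \<open>v' = -d\<close> and \<open>F(x(t)) = \<parallel>d(t)\<parallel>\<^sup>p\<^sup>-\<^sup>1 d(t)\<close>. For a zero \<open>z\<close> of \<open>F\<close>,
  monotonicity gives \<open>(\<parallel>v - z\<parallel>\<^sup>2)' \<le> -2\<parallel>d\<parallel>\<^sup>2\<close>. If \<open>\<parallel>d\<parallel>\<close> is nonincreasing, this yields
  \<open>2t\<parallel>d(t)\<parallel>\<^sup>2 \<le> \<parallel>x\<^sub>0 - z\<parallel>\<^sup>2\<close>, and the rate follows from \<open>\<parallel>F(x(t))\<parallel> = \<parallel>d(t)\<parallel>\<^sup>p\<close>.

  The rescaled field is not monotone, but with \<open>D(d) = \<parallel>d\<parallel>\<^sup>p\<^sup>-\<^sup>1 d\<close> monotonicity of \<open>F\<close> reads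
  \<open>\<langle>d(t) - d(u), D(d(t)) - D(d(u))\<rangle> \<le> \<langle>v(t) - v(u), D(d(t)) - D(d(u))\<rangle>\<close>. Strong monotonicity of \<open>D\<close>
  then makes \<open>d\<close> a Lipschitz function of \<open>v\<close>. Inserting \<open>v(u) - v(t) = -(u - t) d(u) + O((u - t)\<^sup>2)\<close>
  gives \<open>\<parallel>d(u)\<parallel>\<^sup>p - \<parallel>d(t)\<parallel>\<^sup>p \<le> O((u - t)\<^sup>2)\<close>, which forces \<open>\<parallel>d\<parallel>\<close> to be nonincreasing.
\<close>

section \<open>The map \<open>D\<close> with exponent \<open>k = p - 1\<close>: Lipschitz bound on
  balls and strong monotonicity\<close>

definition power_dir :: "nat \<Rightarrow> 'a::real_normed_vector \<Rightarrow> 'a" where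
  "power_dir k a = norm a ^ k *\<^sub>R a"

lemma norm_power_dir: "norm (power_dir k a) = norm a ^ Suc k"
  by (simp add: power_dir_def)

lemma norm_power_dir_diff_le:
  assumes "norm a \<le> M" "norm b \<le> M"
  shows "norm (power_dir k a - power_dir k b) \<le> real (Suc k) * M ^ k * norm (a - b)"
proof (induction k)
  case 0
  then show ?case by (simp add: power_dir_def)
next
  case (Suc k)
  have M: "0 \<le> M" using assms(1) norm_ge_zero order_trans by blast
  have "power_dir (Suc k) a - power_dir (Suc k) b
      = norm a *\<^sub>R (power_dir k a - power_dir k b) + (norm a - norm b) *\<^sub>R power_dir k b"
    by (simp add: power_dir_def algebra_simps)
  then have "norm (power_dir (Suc k) a - power_dir (Suc k) b)
      \<le> norm a * norm (power_dir k a - power_dir k b) + \<bar>norm a - norm b\<bar> * norm b ^ Suc k"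
    by (metis norm_triangle_ineq norm_scaleR norm_power_dir abs_norm_cancel)
  also have "\<dots> \<le> M * (real (Suc k) * M ^ k * norm (a - b)) + norm (a - b) * M ^ Suc k"
    using assms M Suc.IH
    by (intro add_mono mult_mono power_mono norm_triangle_ineq3) auto
  also have "\<dots> = real (Suc (Suc k)) * M ^ Suc k * norm (a - b)"
    by (simp add: algebra_simps)
  finally show ?case .
qed

text \<open>The right side exceeds the left by exactly \<open>(norm a ^ k - norm b ^ k) * ((norm
  a)\<^sup>2 - (norm b)\<^sup>2)\<close>, whose factors never have opposite signs.\<close>

lemma power_dir_strongly_monotone:
  fixes a b :: "'a::real_inner"
  shows "(norm a ^ k + norm b ^ k) * (norm (a - b))\<^sup>2 \<le> 2 * inner (a - b) (power_dir k a - power_dir k b)"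
proof -
  have "0 \<le> (norm a ^ k - norm b ^ k) * ((norm a)\<^sup>2 - (norm b)\<^sup>2)"
  proof (cases "norm a \<le> norm b")
    case True
    then show ?thesis by (intro mult_nonpos_nonpos) (simp_all add: power_mono)
  next
    case False
    then show ?thesis by (intro mult_nonneg_nonneg) (simp_all add: power_mono)
  qed
  also have "\<dots> = 2 * inner (a - b) (power_dir k a - power_dir k b)
      - (norm a ^ k + norm b ^ k) * (norm (a - b))\<^sup>2"
    by (simp add: power_dir_def power2_norm_eq_inner inner_diff_left inner_diff_right
        inner_commute algebra_simps)
  finally show ?thesis by simp
qed

lemma inner_power_dir_diff_ge:
  fixes a b :: "'a::real_inner"
  shows "norm a * (norm a ^ Suc k - norm b ^ Suc k) \<le> inner a (power_dir k a - power_dir k b)"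
proof -
  have "norm b ^ k * inner a b \<le> norm b ^ k * (norm a * norm b)"
    by (intro mult_left_mono norm_cauchy_schwarz) auto
  then show ?thesis
    by (simp add: power_dir_def inner_diff_right dot_square_norm power2_eq_square algebra_simps)
qed

text \<open>With \<open>M\<close> the larger of the two norms, strong monotonicity has modulus at
  least \<open>M ^ k\<close>, while \<open>D\<close> has Lipschitz constant
  \<open>Suc k * M ^ k\<close> on the ball of radius \<open>M\<close>. The powers of
  \<open>M\<close> cancel, so the constant is independent of \<open>a\<close> and
  \<open>b\<close>.\<close>

lemma power_dir_lipschitz_bound:
  fixes a b v w :: "'a::real_inner"
  assumes "inner (a - b) (power_dir k a - power_dir k b) \<le> inner (v - w) (power_dir k a - power_dir k b)"
  shows "norm (a - b) \<le> 2 * real (Suc k) * norm (v - w)"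
proof (cases "a = b")
  case True
  then show ?thesis by simp
next
  case False
  define M where "M = max (norm a) (norm b)"
  have M: "norm a \<le> M" "norm b \<le> M" "M > 0"
    using False by (auto simp: M_def less_max_iff_disj)
  have Mk: "M ^ k \<le> norm a ^ k + norm b ^ k"
    by (auto simp: M_def max_def)
  have "M ^ k * (norm (a - b))\<^sup>2 \<le> (norm a ^ k + norm b ^ k) * (norm (a - b))\<^sup>2"
    using Mk by (intro mult_right_mono) auto
  also have "\<dots> \<le> 2 * inner (a - b) (power_dir k a - power_dir k b)"
    by (rule power_dir_strongly_monotone)
  also have "\<dots> \<le> 2 * (norm (v - w) * norm (power_dir k a - power_dir k b))"
    using assms norm_cauchy_schwarz[of "v - w" "power_dir k a - power_dir k b"] by linarith
  also have "\<dots> \<le> 2 * (norm (v - w) * (real (Suc k) * M ^ k * norm (a - b)))"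
    by (intro mult_left_mono norm_power_dir_diff_le M) auto
  finally have "(M ^ k * norm (a - b)) * norm (a - b)
      \<le> (M ^ k * norm (a - b)) * (2 * real (Suc k) * norm (v - w))"
    by (simp add: power2_eq_square algebra_simps)
  moreover have "M ^ k * norm (a - b) > 0" using M False by simp
  ultimately show ?thesis by (simp add: mult_le_cancel_left_pos)
qed

section \<open>Monotonicity of the speed, from second-order bounds on increments\<close>

lemma nonincreasing_if_quadratic_increments:
  fixes f :: "real \<Rightarrow> real"
  assumes le: "\<And>t u. a \<le> t \<Longrightarrow> t \<le> u \<Longrightarrow> u \<le> b \<Longrightarrow> f u - f t \<le> C * (u - t)\<^sup>2"
    and "a \<le> b"
  shows "f b \<le> f a"
proof -
  \<comment> \<open>Bisection: splitting at the midpoint gives two terms, each with a quarter of the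
    squared length, so each round halves the constant.\<close>
  have halved: "f u - f t \<le> C * (1/2) ^ n * (u - t)\<^sup>2" if "a \<le> t" "t \<le> u" "u \<le> b" for n t u
    using that
  proof (induction n arbitrary: t u)
    case 0
    then show ?case using le by simp
  next
    case (Suc n)
    define m where "m = (t + u) / 2"
    have m: "t \<le> m" "m \<le> u" using Suc.prems by (auto simp: m_def)
    have "f u - f m \<le> C * (1/2) ^ n * (u - m)\<^sup>2" "f m - f t \<le> C * (1/2) ^ n * (m - t)\<^sup>2"
      using Suc.prems m by (auto intro!: Suc.IH)
    then have "f u - f t \<le> C * (1/2) ^ n * (u - m)\<^sup>2 + C * (1/2) ^ n * (m - t)\<^sup>2"
      by linarith
    also have "\<dots> = C * (1/2) ^ Suc n * (u - t)\<^sup>2"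
      by (simp add: m_def power2_eq_square field_simps)
    finally show ?case .
  qed
  have "(\<lambda>n. C * (1/2) ^ n * (b - a)\<^sup>2) \<longlonglongrightarrow> C * 0 * (b - a)\<^sup>2"
    by (intro tendsto_intros) auto
  then have "f b - f a \<le> C * 0 * (b - a)\<^sup>2"
    by (rule LIMSEQ_le_const) (use halved \<open>a \<le> b\<close> in auto)
  then show ?thesis by simp
qed

text \<open>For \<open>x = v - d\<close> and \<open>F(x) = D(d)\<close>, the hypothesis
  \<open>mono\<close> is monotonicity of \<open>F\<close> along the trajectory. The argument works
  with increments of \<open>d\<close>, never with a derivative of it.\<close>

lemma norm_velocity_antimono:
  fixes v d :: "real \<Rightarrow> 'a::real_inner"
  assumes deriv: "\<And>t. t \<ge> 0 \<Longrightarrow> (v has_vector_derivative - d t) (at t within {0..})"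
    and mono: "\<And>t u. t \<ge> 0 \<Longrightarrow> u \<ge> 0 \<Longrightarrow>
      inner (d t - d u) (power_dir k (d t) - power_dir k (d u))
        \<le> inner (v t - v u) (power_dir k (d t) - power_dir k (d u))"
    and nz: "\<And>t. t \<ge> 0 \<Longrightarrow> d t \<noteq> 0"
    and ab: "0 \<le> a" "a \<le> b"
  shows "norm (d b) \<le> norm (d a)"
proof -
  define L where "L = 2 * real (Suc k)"
  have L: "L > 0" by (simp add: L_def)
  have lip: "norm (d t - d u) \<le> L * norm (v t - v u)" if "t \<ge> 0" "u \<ge> 0" for t u
    unfolding L_def by (rule power_dir_lipschitz_bound[OF mono[OF that]])
  have derivS: "(v has_vector_derivative - d t) (at t within S)" if "S \<subseteq> {0..}" "t \<in> S" for t S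
    using deriv that by (meson atLeast_iff has_vector_derivative_within_subset subsetD)
  have cont_v: "continuous_on {a..b} v"
    unfolding continuous_on_eq_continuous_within
    using ab by (auto intro!: has_vector_derivative_continuous derivS)
  have cont_d: "continuous_on {a..b} d"
    unfolding continuous_on_def
  proof
    fix t assume t: "t \<in> {a..b}"
    have "((\<lambda>u. L * norm (v u - v t)) \<longlongrightarrow> L * norm (v t - v t)) (at t within {a..b})"
      using cont_v t by (intro tendsto_intros) (auto simp: continuous_on_def)
    then have lim: "((\<lambda>u. L * norm (v u - v t)) \<longlongrightarrow> 0) (at t within {a..b})" by simp
    have "((\<lambda>u. d u - d t) \<longlongrightarrow> 0) (at t within {a..b})"
      by (rule Lim_null_comparison[OF _ lim])
        (use ab t in \<open>auto simp: eventually_at_filter intro!: always_eventually lip\<close>)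
    then show "(d \<longlongrightarrow> d t) (at t within {a..b})"
      by (simp add: LIM_zero_iff)
  qed
  have cont_nd: "continuous_on {a..b} (\<lambda>t. norm (d t))"
    by (intro continuous_intros cont_d)
  \<comment> \<open>The maximum of the speed controls all Lipschitz constants on
    \<open>{a..b}\<close>; the positive minimum allows division by the speed at the end.\<close>
  obtain t0 where t0: "t0 \<in> {a..b}" "\<And>t. t \<in> {a..b} \<Longrightarrow> norm (d t0) \<le> norm (d t)"
    using continuous_attains_inf[OF compact_Icc _ cont_nd] ab by auto
  obtain t1 where t1: "t1 \<in> {a..b}" "\<And>t. t \<in> {a..b} \<Longrightarrow> norm (d t) \<le> norm (d t1)"
    using continuous_attains_sup[OF compact_Icc _ cont_nd] ab by auto
  define m where "m = norm (d t0)"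
  define M where "M = norm (d t1)"
  have m: "m > 0" using nz[of t0] t0 ab by (simp add: m_def)
  have M: "M > 0" using nz[of t1] t1 ab by (simp add: M_def)
  have lip_v: "norm (v u - v t) \<le> M * \<bar>u - t\<bar>" if "t \<in> {a..b}" "u \<in> {a..b}" for t u
  proof -
    have "norm (v u - v t) \<le> M * norm (u - t)"
    proof (rule differentiable_bound[where S = "{a..b}" and f' = "\<lambda>t h. h *\<^sub>R (- d t)"])
      fix r assume r: "r \<in> {a..b}"
      show "(v has_derivative (\<lambda>h. h *\<^sub>R - d r)) (at r within {a..b})"
        using derivS[of "{a..b}" r] r ab by (simp add: has_vector_derivative_def)
      show "onorm (\<lambda>h. h *\<^sub>R - d r) \<le> M"
        using t1(2)[OF r] by (intro onorm_le) (simp add: M_def mult.commute mult_left_mono)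
    qed (use that in auto)
    then show ?thesis by simp
  qed
  have lip_d: "norm (d u - d t) \<le> L * M * \<bar>u - t\<bar>" if "t \<in> {a..b}" "u \<in> {a..b}" for t u
  proof -
    have "norm (d u - d t) \<le> L * norm (v u - v t)" using that ab by (intro lip) auto
    also have "\<dots> \<le> L * (M * \<bar>u - t\<bar>)" using L lip_v[OF that] by (intro mult_left_mono) auto
    finally show ?thesis by simp
  qed
  \<comment> \<open>Lipschitz constant of \<open>D(d(t))\<close> in time: that of \<open>D\<close>
    on the ball of radius \<open>M\<close> times that of \<open>d\<close>.\<close>
  define K where "K = real (Suc k) * M ^ k * (L * M)"
  have K: "K \<ge> 0" using L M by (simp add: K_def)
  have incr: "norm (d u) ^ Suc k - norm (d t) ^ Suc k \<le> (L * M * K / m) * (u - t)\<^sup>2"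
    if tu: "a \<le> t" "t \<le> u" "u \<le> b" for t u
  \<comment> \<open>The remaining case has \<open>h > 0\<close>, which is cancelled below, and a
    positive increment, so that \<open>norm (d u)\<close> may be replaced by its lower bound
    \<open>m\<close>.\<close>
  proof (cases "t = u \<or> norm (d u) ^ Suc k \<le> norm (d t) ^ Suc k")
    case True
    moreover have "0 \<le> (L * M * K / m) * (u - t)\<^sup>2" using L M K m by simp
    ultimately show ?thesis by (elim disjE) auto
  next
    case False
    define h where "h = u - t"
    have h: "h > 0" using False tu by (auto simp: h_def)
    define W where "W = power_dir k (d u) - power_dir k (d t)"
    have "norm W \<le> real (Suc k) * M ^ k * norm (d u - d t)"
      unfolding W_def M_def by (intro norm_power_dir_diff_le t1(2)) (use tu in auto)
    also have "\<dots> \<le> real (Suc k) * M ^ k * (L * M * h)"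
      using lip_d[of t u] tu M by (intro mult_left_mono) (auto simp: h_def)
    finally have W: "norm W \<le> K * h" by (simp add: K_def mult_ac)
    \<comment> \<open>Linearization about the right endpoint: the lower bound on
      \<open>inner (d u) W\<close> has the sign needed to bound the increment from above.\<close>
    have "norm (v u - v t - (u - t) *\<^sub>R (- d u)) \<le> norm (u - t) * (L * M * h)"
    proof (rule vector_differentiable_bound_linearization[where S = "{t..u}"])
      show "norm (- d r - - d u) \<le> L * M * h" if "r \<in> {t..u}" for r
      proof -
        have "norm (d u - d r) \<le> L * M * \<bar>u - r\<bar>" using that tu by (intro lip_d) auto
        also have "\<dots> \<le> L * M * h" using that L M by (intro mult_left_mono) (auto simp: h_def)
        finally show ?thesis by simp
      qed
    qed (use tu ab derivS in \<open>auto simp: closed_segment_eq_real_ivl\<close>)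
    then have R: "norm (v u - v t + h *\<^sub>R d u) \<le> h * (L * M * h)"
      using h by (simp add: h_def)
    have "0 \<le> (norm (d u) ^ k + norm (d t) ^ k) * (norm (d u - d t))\<^sup>2" by simp
    also have "\<dots> \<le> 2 * inner (d u - d t) W"
      unfolding W_def by (rule power_dir_strongly_monotone)
    also have "\<dots> \<le> 2 * inner (v u - v t) W"
      using mono[of u t] tu ab by (simp add: W_def)
    finally have "0 \<le> inner (v u - v t) W" by simp
    \<comment> \<open>The nonnegative term is added, leaving a remainder of order
      \<open>h\<^sup>2\<close> paired with \<open>W\<close> of order \<open>h\<close>; one factor
      \<open>h\<close> then cancels.\<close>
    then have "h * inner (d u) W \<le> inner (v u - v t + h *\<^sub>R d u) W"
      by (simp add: inner_add_left)
    also have "\<dots> \<le> norm (v u - v t + h *\<^sub>R d u) * norm W" by (rule norm_cauchy_schwarz)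
    also have "\<dots> \<le> (h * (L * M * h)) * (K * h)"
      using R W h L M by (intro mult_mono) auto
    also have "\<dots> = h * (L * M * K * h\<^sup>2)"
      by (simp add: power2_eq_square)
    finally have "inner (d u) W \<le> L * M * K * h\<^sup>2"
      using h by (simp add: mult_le_cancel_left_pos)
    then have "norm (d u) * (norm (d u) ^ Suc k - norm (d t) ^ Suc k) \<le> L * M * K * h\<^sup>2"
      using inner_power_dir_diff_ge[of "d u" k "d t"] unfolding W_def by linarith
    moreover have "m * (norm (d u) ^ Suc k - norm (d t) ^ Suc k)
        \<le> norm (d u) * (norm (d u) ^ Suc k - norm (d t) ^ Suc k)"
      using False t0(2)[of u] tu unfolding m_def by (intro mult_right_mono) auto
    ultimately show ?thesis using m by (simp add: h_def field_simps)
  qed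
  have "norm (d b) ^ Suc k \<le> norm (d a) ^ Suc k"
    by (rule nonincreasing_if_quadratic_increments[OF incr ab(2)])
  then show ?thesis
    by (rule power_le_imp_le_base) simp
qed

section \<open>The rescaled field as a preimage of \<open>F\<close> under \<open>D\<close>\<close>

lemma norm_rescaled:
  assumes "F x \<noteq> 0"
  shows "norm (rescaled F p x) = norm (F x) powr (1 / real p)"
proof -
  have "norm (rescaled F p x) = norm (F x) powr 1 / norm (F x) powr (1 - 1 / real p)"
    using assms by (simp add: rescaled_def divide_inverse mult.commute)
  also have "\<dots> = norm (F x) powr (1 / real p)"
    by (subst powr_diff[symmetric]) simp
  finally show ?thesis .
qed

text \<open>The rescaled vector has norm \<open>norm (F x) powr (1 / p)\<close>; its power
  \<open>p - 1\<close> is exactly the factor divided out.\<close>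

lemma power_dir_rescaled:
  assumes "F x \<noteq> 0"
  shows "power_dir k (rescaled F (Suc k) x) = F x"
proof -
  define r where "r = norm (F x)"
  have r: "r > 0" using assms by (simp add: r_def)
  have "norm (rescaled F (Suc k) x) ^ k = r powr (real k / real (Suc k))"
    using r unfolding norm_rescaled[where F = F, OF assms] r_def[symmetric]
    by (simp add: powr_power mult.commute)
  moreover have "real k / real (Suc k) = 1 - 1 / real (Suc k)"
    by (simp add: field_simps)
  ultimately show ?thesis
    using r by (simp add: power_dir_def rescaled_def r_def)
qed

section \<open>Energy estimate and rate\<close>

theorem theorem2p6:
  fixes F :: "'a::{real_inner, complete_space} \<Rightarrow> 'a"
    and p :: nat
    and x0 :: 'a
    and x v s :: "real \<Rightarrow> 'a"
  assumes "continuous_on UNIV F"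
    and "monotone_operator F"
    and "\<exists>z. F z = 0"
    and "p \<ge> 1"
    and "F x0 \<noteq> 0"
    and "accelerated_rescaled_gradient_solution F p x0 x v s"
  shows "\<exists>C>0. \<forall>t>0. norm (F (x t)) \<le> C * t powr (- real p / 2)"
proof -
  obtain k where p: "p = Suc k" using \<open>p \<ge> 1\<close> by (cases p) auto
  obtain z where z: "F z = 0" using assms(3) by blast
  have F_mono: "inner (F y - F w) (y - w) \<ge> 0" for y w
    using assms(2) by (simp add: monotone_operator_def)
  define d where "d t = rescaled F p (x t)" for t
  have s0: "s 0 = 0" and Fnz: "\<And>t. t \<ge> 0 \<Longrightarrow> F (x t) \<noteq> 0"
    and s_deriv: "\<And>t. t \<ge> 0 \<Longrightarrow> (s has_vector_derivative - d t) (at t within {0..})"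
    and x_eq: "\<And>t. t \<ge> 0 \<Longrightarrow> x t = x0 + s t - d t"
    using assms(6) by (auto simp: accelerated_rescaled_gradient_solution_def d_def algebra_simps)
  \<comment> \<open>Equal to \<open>v\<close> for \<open>t \<ge> 0\<close>; the formula holds at all
    times, so \<open>w\<close> inherits the derivative of \<open>s\<close> directly.\<close>
  define w where "w t = x0 + s t" for t
  have w_deriv: "(w has_vector_derivative - d t) (at t within {0..})" if "t \<ge> 0" for t
    unfolding w_def using s_deriv[OF that] by (auto intro!: derivative_eq_intros)
  have Fd: "power_dir k (d t) = F (x t)" if "t \<ge> 0" for t
    unfolding d_def p by (rule power_dir_rescaled[where F = F, OF Fnz[OF that]])
  have dnz: "d t \<noteq> 0" if "t \<ge> 0" for t
    using Fd[OF that] Fnz[OF that] by (auto simp: power_dir_def)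
  have anti: "norm (d u) \<le> norm (d t)" if "0 \<le> t" "t \<le> u" for t u
  proof (rule norm_velocity_antimono[where v = w and k = k, OF w_deriv _ dnz that])
    fix t u :: real assume tu: "t \<ge> 0" "u \<ge> 0"
    show "inner (d t - d u) (power_dir k (d t) - power_dir k (d u))
        \<le> inner (w t - w u) (power_dir k (d t) - power_dir k (d u))"
      using F_mono[of "x t" "x u"] tu
      by (simp add: Fd x_eq w_def inner_diff_left inner_diff_right inner_add_right inner_commute)
  qed auto
  have decay: "2 * t * (norm (d t))\<^sup>2 \<le> (norm (x0 - z))\<^sup>2" if t: "t > 0" for t
  proof -
    \<comment> \<open>The speed is frozen at the final time \<open>t\<close>; as it is the smallest
      on \<open>{0..t}\<close>, \<open>g\<close> decreases and no integral of the squared speed is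
      needed.\<close>
    define g where "g r = inner (w r - z) (w r - z) + 2 * r * (norm (d t))\<^sup>2" for r
    have g_deriv: "(g has_real_derivative 2 * (norm (d t))\<^sup>2 - 2 * inner (d r) (w r - z)) (at r within {0..t})"
      if "r \<in> {0..t}" for r
    proof -
      have "(w has_vector_derivative - d r) (at r within {0..t})"
        using w_deriv[of r] that
        by (auto intro: has_vector_derivative_within_subset)
      then have "(w has_derivative (\<lambda>h. h *\<^sub>R - d r)) (at r within {0..t})"
        by (simp add: has_vector_derivative_def)
      then show ?thesis
        unfolding g_def has_field_derivative_def
        by (auto intro!: derivative_eq_intros simp: inner_commute algebra_simps)
    qed
    have "g t \<le> g 0"
    proof (rule DERIV_nonpos_imp_decreasing_open[where f = g and a = 0 and b = t])
      show "continuous_on {0..t} g"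
        by (rule DERIV_continuous_on[OF g_deriv])
      fix r assume r: "0 < r" "r < t"
      have "(g has_real_derivative 2 * (norm (d t))\<^sup>2 - 2 * inner (d r) (w r - z)) (at r)"
        using g_deriv[of r] r by (simp add: at_within_Icc_at)
      moreover have "2 * (norm (d t))\<^sup>2 - 2 * inner (d r) (w r - z) \<le> 0"
      proof -
        \<comment> \<open>Monotonicity of \<open>F\<close> against the zero \<open>z\<close>; the
          positive factor cancels, and \<open>w = x + d\<close> then contributes the squared
          speed.\<close>
        have "norm (d r) ^ k * inner (d r) (x r - z) \<ge> 0"
          using F_mono[of "x r" z] z Fd[of r, symmetric] r by (simp add: power_dir_def)
        moreover have "norm (d r) ^ k > 0" using dnz[of r] r by simp
        ultimately have "inner (d r) (x r - z) \<ge> 0"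
          using mult_le_cancel_left_pos[of "norm (d r) ^ k" 0 "inner (d r) (x r - z)"] by simp
        then have "inner (d r) (w r - z) \<ge> (norm (d r))\<^sup>2"
          using r by (simp add: x_eq w_def power2_norm_eq_inner inner_diff_right inner_add_right)
        moreover have "(norm (d t))\<^sup>2 \<le> (norm (d r))\<^sup>2"
          using anti[of r t] r by (intro power_mono) auto
        ultimately show ?thesis by linarith
      qed
      ultimately show "\<exists>y. (g has_real_derivative y) (at r) \<and> y \<le> 0" by blast
    qed (use t in auto)
    moreover have "2 * t * (norm (d t))\<^sup>2 \<le> g t" by (simp add: g_def)
    moreover have "g 0 = (norm (x0 - z))\<^sup>2" by (simp add: g_def w_def s0 power2_norm_eq_inner)
    ultimately show ?thesis by linarith
  qed
  \<comment> \<open>Positive because \<open>F x0 \<noteq> 0\<close> separates \<open>x0\<close> from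
    \<open>z\<close>. Discarding the factor 2 in \<open>decay\<close> gives speed at most
    \<open>B * t powr (- 1 / 2)\<close>, whose power \<open>p\<close> yields the witness
    \<open>B ^ p\<close>.\<close>
  define B where "B = norm (x0 - z)"
  have B: "B > 0" using z assms(5) by (auto simp: B_def)
  show ?thesis
  proof (intro exI[of _ "B ^ p"] conjI allI impI)
    show "B ^ p > 0" using B by simp
    fix t :: real assume t: "t > 0"
    have "t * (norm (d t))\<^sup>2 \<le> B\<^sup>2"
      using decay[OF t] mult_nonneg_nonneg[OF less_imp_le[OF t] zero_le_power2[of "norm (d t)"]]
      unfolding B_def by linarith
    then have "(norm (d t))\<^sup>2 \<le> B\<^sup>2 * (1 / t)"
      using t by (simp add: pos_le_divide_eq mult.commute)
    also have "1 / t = (t powr (- 1 / 2))\<^sup>2"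
      using t powr_minus_divide[of t 1] by (subst powr_power) auto
    finally have "(norm (d t))\<^sup>2 \<le> (B * t powr (- 1 / 2))\<^sup>2"
      by (simp only: power_mult_distrib)
    then have "norm (d t) \<le> B * t powr (- 1 / 2)"
      by (rule power2_le_imp_le) (use B in simp)
    then have "norm (d t) ^ p \<le> (B * t powr (- 1 / 2)) ^ p"
      by (intro power_mono) auto
    also have "\<dots> = B ^ p * t powr (- real p / 2)"
      using t by (subst power_mult_distrib, subst powr_power) auto
    finally show "norm (F (x t)) \<le> B ^ p * t powr (- real p / 2)"
      using Fd[of t] norm_power_dir[of k "d t"] t by (simp add: p)
  qed
qed

end
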